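(* There exist a constant $c>0$ and, for infinitely many positive integers $n$, a graph $G$ on $n$ vertices with $c_b(G)=1$ and $\mathrm{capt}_b(G)\ge c n^2$; that is, there are graphs with bridge-burning cop number 1 and $\mathrm{capt}_b(G)=\Omega(n^2)$.
   Context: Bridge-burning Cops and Robbers is played on a finite graph $G$ by a team of cops and a single robber, with full information. First each cop chooses a starting vertex (several cops may share a vertex), then the robber chooses a starting vertex. The game then proceeds in rounds; in each round, first every cop either stays put or moves along an edge of the current graph to an adjacent vertex, and then the robber either stays put or moves along an edge of the current graph. Every edge traversed by the robber is immediately deleted from the graph (cop moves delete nothing). The cops win if at some moment some cop occupies the same vertex as the robber; the robber wins if he avoids this forever. $c_b(G)$ is the minimum number of cops for which the cops have a winning strategy. The bridge-burning capture time $\mathrm{capt}_b(G)$ is the minimum number of rounds within which $c_b(G)$ cops can guarantee capturing the robber. *)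

theory Defs
  imports Complex_Main "Graph_Theory.Pair_Digraph"
begin

text \<open>
  Finite simple graphs are the \<open>pair_graph\<close>s of the AFP entry Graph_Theory: an undirected edge
  \<open>uv\<close> is the pair of arcs \<open>(u, v)\<close> and \<open>(v, u)\<close>, so deleting it removes both arcs. Graphs are
  loopless, hence \<open>burn G u u = G\<close> for a robber who stays put.
\<close>

definition may_move :: "'a pair_pre_digraph \<Rightarrow> 'a \<Rightarrow> 'a \<Rightarrow> bool" where
  "may_move G u v \<longleftrightarrow> u = v \<or> (u, v) \<in> parcs G"

definition burn :: "'a pair_pre_digraph \<Rightarrow> 'a \<Rightarrow> 'a \<Rightarrow> 'a pair_pre_digraph" where
  "burn G u v = G\<lparr>parcs := parcs G - {(u, v), (v, u)}\<rparr>"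

text \<open>
  A robber trajectory \<open>r\<close> consists of the starting vertex \<open>r 0\<close> and the positions \<open>r i\<close> at the end
  of round \<open>i\<close>. It alone determines the current graph \<open>burnt G r i\<close> at the end of round \<open>i\<close>.
  Trajectories are infinite: after a capture, they are continued in an arbitrary legal way (for
  example by staying put), which has no effect on whether and when the first capture takes place.
\<close>

primrec burnt :: "'a pair_pre_digraph \<Rightarrow> (nat \<Rightarrow> 'a) \<Rightarrow> nat \<Rightarrow> 'a pair_pre_digraph" where
  "burnt G r 0 = G"
| "burnt G r (Suc i) = burn (burnt G r i) (r i) (r (Suc i))"

definition robber_play :: "'a pair_pre_digraph \<Rightarrow> (nat \<Rightarrow> 'a) \<Rightarrow> bool" where
  "robber_play G r \<longleftrightarrow>
     r 0 \<in> pverts G \<and> (\<forall>i. may_move (burnt G r i) (r i) (r (Suc i)))"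

text \<open>
  A strategy of \<open>k\<close> cops maps the history of the robber's positions to the list of positions of
  the \<open>k\<close> cops (entry \<open>j\<close> belongs to cop \<open>j\<close>): \<open>\<sigma> []\<close> is the initial placement, chosen before the
  robber's, and \<open>\<sigma> [r 0, \<dots>, r i]\<close> is the placement after the cops' move in round \<open>i + 1\<close>. The
  cops' own earlier positions and the current graph are determined by \<open>\<sigma>\<close> and this history,
  so such strategies have full information.
\<close>

definition cops_at :: "('a list \<Rightarrow> 'a list) \<Rightarrow> (nat \<Rightarrow> 'a) \<Rightarrow> nat \<Rightarrow> 'a list" where
  "cops_at \<sigma> r i = \<sigma> (map r [0..<i])"

definition cop_strategy :: "'a pair_pre_digraph \<Rightarrow> nat \<Rightarrow> ('a list \<Rightarrow> 'a list) \<Rightarrow> bool" where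
  "cop_strategy G k \<sigma> \<longleftrightarrow>
     length (\<sigma> []) = k \<and> set (\<sigma> []) \<subseteq> pverts G \<and>
     (\<forall>r. robber_play G r \<longrightarrow>
        (\<forall>i. list_all2 (may_move (burnt G r i)) (cops_at \<sigma> r i) (cops_at \<sigma> r (Suc i))))"

text \<open>
  The first disjunct covers the robber's choice of \<open>r 0\<close> (round \<open>0\<close>) and the moments after the
  robber's moves, the second one the moments after the cops' moves.
\<close>

definition captured_within :: "('a list \<Rightarrow> 'a list) \<Rightarrow> (nat \<Rightarrow> 'a) \<Rightarrow> nat \<Rightarrow> bool" where
  "captured_within \<sigma> r t \<longleftrightarrow>
     (\<exists>i\<le>t. r i \<in> set (cops_at \<sigma> r i)) \<or> (\<exists>i<t. r i \<in> set (cops_at \<sigma> r (Suc i)))"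

definition cops_win :: "'a pair_pre_digraph \<Rightarrow> nat \<Rightarrow> bool" where
  "cops_win G k \<longleftrightarrow>
     (\<exists>\<sigma>. cop_strategy G k \<sigma> \<and> (\<forall>r. robber_play G r \<longrightarrow> (\<exists>t. captured_within \<sigma> r t)))"

definition cops_win_within :: "'a pair_pre_digraph \<Rightarrow> nat \<Rightarrow> nat \<Rightarrow> bool" where
  "cops_win_within G k t \<longleftrightarrow>
     (\<exists>\<sigma>. cop_strategy G k \<sigma> \<and> (\<forall>r. robber_play G r \<longrightarrow> captured_within \<sigma> r t))"

text \<open>
  Both minima exist for every finite graph: a cop on each vertex wins at once, and, as there are
  only finitely many moves at each point, a winning strategy captures within a bounded time.
\<close>

definition bb_cop_number :: "'a pair_pre_digraph \<Rightarrow> nat" where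
  "bb_cop_number G = (LEAST k. cops_win G k)"

definition bb_capture_time :: "'a pair_pre_digraph \<Rightarrow> nat" where
  "bb_capture_time G = (LEAST t. cops_win_within G (bb_cop_number G) t)"

end

theory Submission
  imports Defs
begin

text \<open>
  The witnesses are the complete bipartite graphs. A cop who alternates between two adjacent
  vertices always threatens or guards a whole side: the robber has to change sides in every round,
  and as he burns an edge each time, he eventually runs out of edges. On the other hand, the robber
  is never in danger on the cop's own side, unless the cop stands on the same vertex, so it
  suffices for him to change sides whenever the cop does, and to choose between two twin vertices
  one that avoids the cop. He can do so for a quadratic number of rounds by following, up to
  twins, a trail of quadratic length.
\<close>

text \<open>The complete bipartite graph between the even and the odd numbers below
  \<open>n\<close>; lying on the same side becomes \<open>even (x + y)\<close>.\<close>

definition parity_graph :: "nat \<Rightarrow> nat pair_pre_digraph" where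
  "parity_graph n = \<lparr>pverts = {..<n}, parcs = {(x, y). x < n \<and> y < n \<and> odd (x + y)}\<rparr>"

lemma pverts_parity_graph [simp]: "pverts (parity_graph n) = {..<n}"
  by (simp add: parity_graph_def)

lemma parcs_parity_graph:
  "(x, y) \<in> parcs (parity_graph n) \<longleftrightarrow> x < n \<and> y < n \<and> odd (x + y)"
  by (simp add: parity_graph_def)

lemma finite_parcs_parity_graph: "finite (parcs (parity_graph n))"
  by (rule finite_subset[of _ "{..<n} \<times> {..<n}"]) (auto simp: parity_graph_def)

lemma pair_graph_parity_graph: "pair_graph (parity_graph n)"
proof unfold_locales
  show "finite (parcs (parity_graph n))"
    by (rule finite_parcs_parity_graph)
  show "symmetric (with_proj (parity_graph n))"
    by (auto simp: parity_graph_def symmetric_def sym_def add.commute)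
qed (auto simp: parity_graph_def)

subsection \<open>Burnt graphs\<close>

lemma parcs_burnt_iff:
  "(x, y) \<in> parcs (burnt G r i) \<longleftrightarrow>
     (x, y) \<in> parcs G \<and> (\<forall>j<i. {x, y} \<noteq> {r j, r (Suc j)})"
  by (induction i) (auto simp: burn_def doubleton_eq_iff less_Suc_eq)

lemma burnt_cong: "(\<And>j. j \<le> i \<Longrightarrow> r j = r' j) \<Longrightarrow> burnt G r i = burnt G r' i"
  by (induction i) auto

text \<open>Each move burns an arc that was still present, so the number of arcs bounds the number
  of moves.\<close>

lemma card_parcs_burnt:
  assumes "finite (parcs G)" "robber_play G r" "\<And>j. j < i \<Longrightarrow> r j \<noteq> r (Suc j)"
  shows "card (parcs (burnt G r i)) + i \<le> card (parcs G)"
  using assms(3)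
proof (induction i)
  case (Suc i)
  let ?B = "parcs (burnt G r i)" and ?C = "parcs (burnt G r (Suc i))"
  have "finite ?B"
    by (rule finite_subset[OF _ assms(1)]) (auto simp: parcs_burnt_iff)
  moreover have "(r i, r (Suc i)) \<in> ?B"
    using assms(2) Suc.prems[of i] by (auto simp: robber_play_def may_move_def)
  hence "?C \<subset> ?B"
    by (auto simp: burn_def)
  ultimately have "card ?C < card ?B"
    by (rule psubset_card_mono)
  thus ?case
    using Suc by simp
qed simp

subsection \<open>The cop's strategy\<close>

text \<open>The test for legality only matters after a capture.\<close>

primrec alternating_cop :: "nat pair_pre_digraph \<Rightarrow> (nat \<Rightarrow> nat) \<Rightarrow> nat \<Rightarrow> nat" where
  "alternating_cop G r 0 = 1"
| "alternating_cop G r (Suc i) =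
     (let p = alternating_cop G r i; q = (if odd (p + r i) then r i else 1 - p)
      in if may_move (burnt G r i) p q then q else p)"

text \<open>\<open>nth h\<close> is unspecified beyond the history, but
  \<open>alternating_cop G r i\<close> reads \<open>r\<close> only below \<open>i\<close>.\<close>

definition alternating_strategy :: "nat pair_pre_digraph \<Rightarrow> nat list \<Rightarrow> nat list" where
  "alternating_strategy G h = [alternating_cop G (nth h) (length h)]"

lemma alternating_cop_cong:
  "(\<And>j. j < i \<Longrightarrow> r j = r' j) \<Longrightarrow> alternating_cop G r i = alternating_cop G r' i"
proof (induction i)
  case (Suc i)
  have "burnt G r i = burnt G r' i"
    by (rule burnt_cong) (simp add: Suc.prems)
  with Suc show ?case
    by (simp add: Let_def)
qed simp

lemma cops_at_alternating_strategy:
  "cops_at (alternating_strategy G) r i = [alternating_cop G r i]"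
  by (auto simp: cops_at_def alternating_strategy_def intro: alternating_cop_cong)

lemma cop_strategy_alternating_strategy:
  assumes "1 \<in> pverts G"
  shows "cop_strategy G 1 (alternating_strategy G)"
  using assms
  by (auto simp: cop_strategy_def cops_at_alternating_strategy alternating_strategy_def Let_def
      may_move_def)

lemma captured_by_alternating_strategy:
  assumes n: "n \<ge> 2" and play: "robber_play (parity_graph n) r"
  defines "T \<equiv> card (parcs (parity_graph n)) + 2"
  shows "captured_within (alternating_strategy (parity_graph n)) r T"
proof (rule ccontr)
  define G where "G = parity_graph n"
  define c where "c = alternating_cop G r"
  assume "\<not> ?thesis"
  hence free: "\<And>i. i \<le> T \<Longrightarrow> r i \<noteq> c i" "\<And>i. i < T \<Longrightarrow> r i \<noteq> c (Suc i)"
    by (auto simp: captured_within_def cops_at_alternating_strategy c_def G_def)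
  have r_less: "r i < n" for i
  proof (induction i)
    case (Suc i)
    have "may_move (burnt G r i) (r i) (r (Suc i))"
      using play by (simp add: robber_play_def G_def)
    with Suc show ?case
      by (auto simp: may_move_def parcs_burnt_iff G_def parcs_parity_graph)
  qed (use play in \<open>simp add: robber_play_def\<close>)
  \<comment> \<open>Until a capture the cop visits 1, 0, 1, 0, ..., and before each cop move the
    robber is on the cop's side, but not at 0 or 1: on the opposite side he would be caught at once,
    and the only one of 0 and 1 on the cop's side is the cop's own vertex.\<close>
  have inv: "c i = Suc i mod 2 \<and> (\<forall>j<i. r j \<ge> 2 \<and> even (c j + r j))" if "i \<le> T" for i
    using that
  proof (induction i)
    case (Suc i)
    hence ci: "c i = Suc i mod 2" and old: "\<And>j. j < i \<Longrightarrow> r j \<ge> 2"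
      by auto
    \<comment> \<open>The cop's next edge is intact: a burnt edge starts at some
      \<open>r j \<ge> 2\<close>, so it meets \<open>c i < 2\<close> only if the robber moved onto
      \<open>c i\<close>; as his earlier positions are at least 2, that was his last move, a
      capture.\<close>
    have edge: "(c i, x) \<in> parcs (burnt G r i)" if "x = r i \<or> x < 2" "x < n" "odd (c i + x)" for x
    proof -
      have "{c i, x} \<noteq> {r j, r (Suc j)}" if j: "j < i" for j
      proof
        assume eq: "{c i, x} = {r j, r (Suc j)}"
        have "c i < 2"
          using ci by simp
        hence "c i = r (Suc j)" "x = r j"
          using eq old[OF j] by (auto simp: doubleton_eq_iff)
        moreover have "x = r i"
          using \<open>x = r i \<or> x < 2\<close> \<open>x = r j\<close> old[OF j] by auto
        moreover have "Suc j = i"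
          using \<open>c i = r (Suc j)\<close> \<open>c i < 2\<close> old[of "Suc j"] j by (metis Suc_lessI not_less)
        ultimately show False
          using free(1)[of i] Suc.prems by simp
      qed
      moreover have "c i < n"
        using ci n by (metis mod_less_divisor order_less_le_trans zero_less_numeral)
      ultimately show ?thesis
        using that by (auto simp: parcs_burnt_iff G_def parcs_parity_graph)
    qed
    have even: "even (c i + r i)"
    proof (rule ccontr)
      assume odd: "odd (c i + r i)"
      hence "c (Suc i) = r i"
        using edge[of "r i"] r_less by (simp add: c_def Let_def may_move_def)
      thus False
        using free(2)[of i] Suc.prems by simp
    qed
    have "1 - c i < 2" "odd (c i + (1 - c i))"
      using ci by (auto simp: mod2_eq_if)
    hence "c (Suc i) = 1 - c i"
      using even edge[of "1 - c i"] n by (simp add: c_def Let_def may_move_def)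
    moreover have "r i \<ge> 2"
    proof (rule ccontr)
      assume "\<not> r i \<ge> 2"
      hence "r i = c i"
        using even ci by (auto simp: mod2_eq_if less_2_cases_iff not_le split: if_splits)
      thus False
        using free(1)[of i] Suc.prems by simp
    qed
    ultimately show ?case
      using Suc ci even by (auto simp: less_Suc_eq mod2_eq_if)
  qed (simp add: c_def)
  \<comment> \<open>\<open>T\<close> exceeds the number of arcs by 2: one more move than there are
    arcs, and one further cop move that forces the last position onto the cop's side.\<close>
  have "r j \<noteq> r (Suc j)" if "j < Suc (card (parcs G))" for j
  proof -
    have "even (c j + r j)" "even (c (Suc j) + r (Suc j))"
      using inv[of T] that by (auto simp: T_def G_def)
    moreover have "c j = Suc j mod 2" "c (Suc j) = Suc (Suc j) mod 2"
      using inv[of j] inv[of "Suc j"] that by (auto simp: T_def G_def)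
    ultimately show ?thesis
      by (auto simp: mod2_eq_if split: if_splits)
  qed
  thus False
    using card_parcs_burnt[of G r "Suc (card (parcs G))"] play finite_parcs_parity_graph
    by (simp add: G_def)
qed

section \<open>The cop number of the complete bipartite graphs\<close>

lemma cops_win_within_parity_graph:
  assumes "n \<ge> 2"
  shows "cops_win_within (parity_graph n) 1 (card (parcs (parity_graph n)) + 2)"
  unfolding cops_win_within_def
  using captured_by_alternating_strategy[OF assms] cop_strategy_alternating_strategy assms
  by (intro exI[of _ "alternating_strategy (parity_graph n)"]) auto

text \<open>A robber who never moves defeats the empty team.\<close>

lemma not_cops_win_0:
  assumes "x \<in> pverts G"
  shows "\<not> cops_win G 0"
proof
  assume "cops_win G 0"
  then obtain \<sigma> where strategy: "cop_strategy G 0 \<sigma>"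
    and win: "\<And>r. robber_play G r \<Longrightarrow> \<exists>t. captured_within \<sigma> r t"
    by (auto simp: cops_win_def)
  have play: "robber_play G (\<lambda>_. x)"
    using assms by (simp add: robber_play_def may_move_def)
  have "cops_at \<sigma> (\<lambda>_. x) i = []" for i
  proof (induction i)
    case 0
    show ?case
      using strategy by (simp add: cop_strategy_def cops_at_def)
  next
    case (Suc i)
    have "length (cops_at \<sigma> (\<lambda>_. x) i) = length (cops_at \<sigma> (\<lambda>_. x) (Suc i))"
      using strategy play unfolding cop_strategy_def by (blast intro: list_all2_lengthD)
    with Suc show ?case
      by simp
  qed
  thus False
    using win[OF play] by (simp add: captured_within_def)
qed

lemma bb_cop_number_parity_graph:
  assumes "n \<ge> 2"
  shows "bb_cop_number (parity_graph n) = 1"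
  unfolding bb_cop_number_def
proof (rule Least_equality)
  show "cops_win (parity_graph n) 1"
    using cops_win_within_parity_graph[OF assms] by (auto simp: cops_win_def cops_win_within_def)
  show "1 \<le> k" if "cops_win (parity_graph n) k" for k
    using that not_cops_win_0[of 0 "parity_graph n"] assms
    by (cases k) auto
qed

subsection \<open>A long trail in a complete bipartite graph\<close>

text \<open>
  The \<open>e\<close>-th of \<open>h\<close> closed walks of length \<open>4 * h\<close> consists of edges from \<open>2 * a\<close> to \<open>2 * b + 1\<close>
  with \<open>b - a = 2 * e\<close> and \<open>b - a = 2 * e - 1\<close> (except for its last edge, which leads back to \<open>0\<close>).
\<close>

definition trail :: "nat \<Rightarrow> nat \<Rightarrow> nat" where
  "trail h j = (let q = j div 2; k = 2 * h
     in if even j then 2 * (q mod k) else 2 * (q mod k + 2 * (q div k)) + 1)"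

lemma even_trail_iff [simp]: "even (trail h j) \<longleftrightarrow> even j"
  by (simp add: trail_def Let_def)

lemma trail_less:
  assumes "j \<le> 4 * h\<^sup>2" "h > 0"
  shows "trail h j < 8 * h"
proof -
  define q where "q = j div 2"
  have m: "q mod (2 * h) < 2 * h"
    using assms by simp
  have "q \<le> h * (2 * h)"
    using assms unfolding q_def power2_eq_square by linarith
  hence "q div (2 * h) \<le> h"
    using assms div_le_mono[of q "h * (2 * h)" "2 * h"] by simp
  \<comment> \<open>At \<open>j = 4 * h\<^sup>2\<close> the quotient is \<open>h\<close>, but only
    odd positions use it.\<close>
  moreover have "q div (2 * h) < h" if "odd j"
  proof -
    have "q < h * (2 * h)"
      using assms that unfolding q_def power2_eq_square by (auto elim!: oddE)
    thus ?thesis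
      by (simp add: less_mult_imp_div_less)
  qed
  ultimately show ?thesis
    using m by (auto simp: trail_def Let_def q_def[symmetric])
qed

lemma doubleton_even_odd_eq_iff:
  "{2 * x, 2 * y + 1} = {2 * x', 2 * y' + 1} \<longleftrightarrow> x = x' \<and> y = y'" for x y x' y' :: nat
proof -
  have "2 * x \<noteq> 2 * y' + 1" for x y' :: nat
    by presburger
  thus ?thesis
    by (auto simp: doubleton_eq_iff)
qed

text \<open>The difference of the halved ends is even on steps out of even positions and odd on the
  others, which reveals the parity of the index; the edge then determines \<open>a\<close> and
  \<open>e\<close>.\<close>

lemma trail_edges_distinct:
  assumes "i < 4 * h\<^sup>2" "j < 4 * h\<^sup>2"
    and eq: "{trail h i, trail h (Suc i)} = {trail h j, trail h (Suc j)}"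
  shows "i = j"
proof -
  define k where "k = 2 * h"
  have coords: "\<exists>e a. l div 2 = e * k + a \<and> e < h \<and> a < k \<and>
      (even l \<longrightarrow> trail h l = 2 * a \<and> trail h (Suc l) = 2 * (a + 2 * e) + 1) \<and>
      (odd l \<longrightarrow> trail h l = 2 * (a + 2 * e) + 1 \<and>
         trail h (Suc l) = (if Suc a = k then 0 else 2 * Suc a))" if l: "l < 4 * h\<^sup>2" for l
  proof (intro exI conjI impI)
    have "k > 0"
      using l by (cases h) (auto simp: k_def)
    show "l div 2 = l div 2 div k * k + l div 2 mod k"
      by simp
    have "l div 2 < h * k"
      using l unfolding k_def power2_eq_square by linarith
    thus "l div 2 div k < h"
      by (simp add: less_mult_imp_div_less)
    show "l div 2 mod k < k"
      using \<open>k > 0\<close> by simp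
    show "trail h (Suc l) = (if Suc (l div 2 mod k) = k then 0 else 2 * Suc (l div 2 mod k))"
      if "odd l"
      using that by (auto simp: trail_def Let_def k_def[symmetric] mod_Suc)
  qed (auto simp: trail_def Let_def k_def)
  obtain e a where ea: "i div 2 = e * k + a" "e < h" "a < k"
      "even i \<Longrightarrow> trail h i = 2 * a \<and> trail h (Suc i) = 2 * (a + 2 * e) + 1"
      "odd i \<Longrightarrow> trail h i = 2 * (a + 2 * e) + 1 \<and>
         trail h (Suc i) = (if Suc a = k then 0 else 2 * Suc a)"
    using coords[OF assms(1)] by blast
  obtain f b where fb: "j div 2 = f * k + b" "f < h" "b < k"
      "even j \<Longrightarrow> trail h j = 2 * b \<and> trail h (Suc j) = 2 * (b + 2 * f) + 1"
      "odd j \<Longrightarrow> trail h j = 2 * (b + 2 * f) + 1 \<and>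
         trail h (Suc j) = (if Suc b = k then 0 else 2 * Suc b)"
    using coords[OF assms(2)] by blast
  \<comment> \<open>The cyclic successor below \<open>k\<close>. As \<open>k\<close> is even, it
    changes parity even when it wraps around; \<open>shifted\<close> rests on this.\<close>
  define s where "s x = (if Suc x = k then 0 else Suc x)" for x
  have double_s: "(if Suc x = k then 0 else 2 * Suc x) = 2 * s x" for x
    by (simp add: s_def)
  have shifted: False if "s x + 2 * u = x + 2 * v" for x u v
  proof -
    have "odd (s x + x)"
      by (simp add: s_def k_def) presburger
    moreover have "even (s x + 2 * u + x)"
      unfolding that by simp
    ultimately show False
      by simp
  qed
  note ends = ea(4,5)[unfolded double_s] fb(4,5)[unfolded double_s]
  have "e = f \<and> a = b \<and> even i = even j"
  proof (cases "even i"; cases "even j")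
    assume "even i" "even j"
    hence "{2 * a, 2 * (a + 2 * e) + 1} = {2 * b, 2 * (b + 2 * f) + 1}"
      using ends eq by simp
    hence "a = b" "a + 2 * e = b + 2 * f"
      unfolding doubleton_even_odd_eq_iff by blast+
    thus ?thesis
      using \<open>even i\<close> \<open>even j\<close> by simp
  next
    assume "even i" "odd j"
    hence "{2 * a, 2 * (a + 2 * e) + 1} = {2 * s b, 2 * (b + 2 * f) + 1}"
      using ends eq by (simp add: insert_commute)
    hence "a = s b" "a + 2 * e = b + 2 * f"
      unfolding doubleton_even_odd_eq_iff by blast+
    thus ?thesis
      using shifted[of b e f] by simp
  next
    assume "odd i" "even j"
    hence "{2 * s a, 2 * (a + 2 * e) + 1} = {2 * b, 2 * (b + 2 * f) + 1}"
      using ends eq by (simp add: insert_commute)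
    hence "s a = b" "a + 2 * e = b + 2 * f"
      unfolding doubleton_even_odd_eq_iff by blast+
    thus ?thesis
      using shifted[of a f e] by simp
  next
    assume "odd i" "odd j"
    hence "{2 * s a, 2 * (a + 2 * e) + 1} = {2 * s b, 2 * (b + 2 * f) + 1}"
      using ends eq by (simp add: insert_commute)
    hence "s a = s b" "a + 2 * e = b + 2 * f"
      unfolding doubleton_even_odd_eq_iff by blast+
    moreover from this(1) have "a = b"
      by (auto simp: s_def split: if_splits)
    ultimately show ?thesis
      using \<open>odd i\<close> \<open>odd j\<close> by simp
  qed
  thus ?thesis
    using ea(1) fb(1) by (metis div_mult_mod_eq mod2_eq_if)
qed

subsection \<open>The robber's strategy\<close>

text \<open>
  The state consists of the history and the current index in the trail, where \<open>w j\<close> and its twin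
  \<open>w j + m\<close> both represent the \<open>j\<close>-th vertex of the trail. The initial index is \<open>0\<close> or \<open>1\<close>, so that
  the robber starts on the cop's side.
\<close>

primrec evader :: "(nat list \<Rightarrow> nat list) \<Rightarrow> nat \<Rightarrow> nat \<Rightarrow> (nat \<Rightarrow> nat) \<Rightarrow> nat \<Rightarrow> nat list \<times> nat" where
  "evader \<sigma> m L w 0 =
     (let c = hd (\<sigma> []); j = c mod 2 in ([if c = w j then w j + m else w j], j))"
| "evader \<sigma> m L w (Suc i) =
     (let (h, j) = evader \<sigma> m L w i; c = hd (\<sigma> h)
      in if odd (c + last h) \<and> j < L
         then (h @ [if c = w (Suc j) then w (Suc j) + m else w (Suc j)], Suc j)
         else (h @ [last h], j))"

text \<open>\<open>evader\<close> spends at most one trail edge per round, so its trail outlasts any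
  game of fewer than \<open>L\<close> rounds. Reduction modulo \<open>m\<close> identifies twins,
  and evenness of \<open>m\<close> puts them on the same side.\<close>

lemma trail_length_le_capture_time:
  fixes m L :: nat and w :: "nat \<Rightarrow> nat"
  assumes L: "L > 0" and m: "even m" and w_less: "\<And>j. j \<le> L \<Longrightarrow> w j < m"
    and w_even: "\<And>j. even (w j) \<longleftrightarrow> even j"
    and w_inj: "\<And>i j. i < L \<Longrightarrow> j < L \<Longrightarrow> {w i, w (Suc i)} = {w j, w (Suc j)} \<Longrightarrow> i = j"
    and win: "cops_win_within (parity_graph (2 * m)) 1 t"
  shows "L \<le> t"
proof (rule ccontr)
  assume "\<not> L \<le> t"
  hence t: "t < L"
    by simp
  define G where "G = parity_graph (2 * m)"
  obtain \<sigma> where \<sigma>: "cop_strategy G 1 \<sigma>"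
    and captured: "\<And>r. robber_play G r \<Longrightarrow> captured_within \<sigma> r t"
    using win by (auto simp: cops_win_within_def G_def)
  define r where "r i = last (fst (evader \<sigma> m L w i))" for i
  define k where "k i = snd (evader \<sigma> m L w i)" for i
  define c where "c i = hd (cops_at \<sigma> r i)" for i
  define avoid where "avoid j p = (if p = w j then w j + m else w j)" for j p
  \<comment> \<open>\<open>evader\<close> carries its own history, so \<open>\<sigma>\<close> is
    consulted on exactly the trajectory \<open>r\<close>, and \<open>c\<close> is the actual path of
    the cop.\<close>
  have "fst (evader \<sigma> m L w 0) = [r 0]"
    "fst (evader \<sigma> m L w (Suc i)) = fst (evader \<sigma> m L w i) @ [r (Suc i)]" for i
    by (auto simp: r_def Let_def split: prod.splits)
  hence history: "fst (evader \<sigma> m L w i) = map r [0..<Suc i]" for i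
    by (induction i) (simp_all del: evader.simps)
  have c_Suc: "c (Suc i) = hd (\<sigma> (fst (evader \<sigma> m L w i)))" for i
    by (simp add: c_def cops_at_def history)
  have start: "r 0 = avoid (k 0) (c 0)" "k 0 = c 0 mod 2"
    by (simp_all add: r_def k_def c_def cops_at_def avoid_def Let_def)
  have move: "r (Suc i) = avoid (Suc (k i)) (c (Suc i))" "k (Suc i) = Suc (k i)"
    if "odd (c (Suc i) + r i)" "k i < L" for i
    using that unfolding c_Suc by (auto simp: r_def k_def avoid_def Let_def split: prod.splits)
  have stay: "r (Suc i) = r i" "k (Suc i) = k i" if "\<not> (odd (c (Suc i) + r i) \<and> k i < L)" for i
    using that unfolding c_Suc by (auto simp: r_def k_def avoid_def Let_def split: prod.splits)
  have avoid: "avoid j p mod m = w j" "avoid j p < 2 * m" "even (avoid j p) \<longleftrightarrow> even j"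
      "avoid j p \<noteq> p" if "j \<le> L" for j p
    using w_less[OF that] m w_even[of j] by (auto simp: avoid_def)
  \<comment> \<open>\<open>Suc i\<close> allows for the initial index 1. Every past move projects
    modulo \<open>m\<close> to a trail edge of index below \<open>k i\<close>, so edge number
    \<open>k i\<close> is still unburnt.\<close>
  have inv: "k i \<le> L \<and> k i \<le> Suc i \<and> r i mod m = w (k i) \<and> r i < 2 * m \<and> (even (r i) \<longleftrightarrow> even (k i)) \<and>
      (\<forall>l<i. r l = r (Suc l) \<or>
        (\<exists>j<k i. r l mod m = w j \<and> r (Suc l) mod m = w (Suc j)))" for i
  proof (induction i)
    case 0
    have "k 0 \<le> 1"
      by (simp add: start)
    thus ?case
      using avoid[of "k 0"] L by (simp add: start(1))
  next
    case (Suc i)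
    show ?case
    proof (cases "odd (c (Suc i) + r i) \<and> k i < L")
      case True
      thus ?thesis
        using Suc move[of i] avoid[of "Suc (k i)"] by (auto simp: less_Suc_eq)
    next
      case False
      thus ?thesis
        using Suc stay[of i] by (auto simp: less_Suc_eq)
    qed
  qed
  have play: "robber_play G r"
    unfolding robber_play_def
  proof (intro conjI allI)
    show "r 0 \<in> pverts G"
      using inv[of 0] by (simp add: G_def)
    show "may_move (burnt G r i) (r i) (r (Suc i))" for i
    proof (cases "r (Suc i) = r i")
      case False
      hence "k i < L"
        using stay[of i] by blast
      have k: "k (Suc i) = Suc (k i)"
        using False stay[of i] move[of i] by blast
      have "{r i, r (Suc i)} \<noteq> {r l, r (Suc l)}" if l: "l < i" for l
      proof
        assume eq: "{r i, r (Suc i)} = {r l, r (Suc l)}"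
        with False have "r l \<noteq> r (Suc l)"
          by (auto simp: doubleton_eq_iff)
        then obtain j where j: "j < k i" "r l mod m = w j" "r (Suc l) mod m = w (Suc j)"
          using inv[of i] l by blast
        from eq have "(\<lambda>x. x mod m) ` {r i, r (Suc i)} = (\<lambda>x. x mod m) ` {r l, r (Suc l)}"
          by simp
        hence "{w (k i), w (Suc (k i))} = {w j, w (Suc j)}"
          using inv[of i] inv[of "Suc i"] k j by simp
        thus False
          using w_inj[of "k i" j] \<open>k i < L\<close> j by simp
      qed
      thus ?thesis
        using inv[of i] inv[of "Suc i"] k
        by (simp add: may_move_def parcs_burnt_iff G_def parcs_parity_graph)
    qed (simp add: may_move_def)
  qed
  have legal: "list_all2 (may_move (burnt G r i)) (cops_at \<sigma> r i) (cops_at \<sigma> r (Suc i))" for i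
    using \<sigma> play by (simp add: cop_strategy_def)
  have "length (cops_at \<sigma> r i) = 1" for i
  proof (induction i)
    case 0
    show ?case
      using \<sigma> by (simp add: cop_strategy_def cops_at_def)
  next
    case (Suc i)
    thus ?case
      using list_all2_lengthD[OF legal[of i]] by simp
  qed
  hence cops_at: "cops_at \<sigma> r i = [c i]" for i
    by (simp add: c_def length_Suc_conv) (metis list.sel(1))
  have cop_move: "c (Suc i) = c i \<or> odd (c i + c (Suc i))" for i
    using legal[of i]
    by (auto simp: cops_at may_move_def parcs_burnt_iff G_def parcs_parity_graph)
  \<comment> \<open>\<open>k i \<le> Suc i \<le> t < L\<close>: the trail is not exhausted within
    \<open>t\<close> rounds.\<close>
  have k_less: "k i < L" if "i < t" for i
    using inv[of i] that t by simp
  \<comment> \<open>If the cop crosses, so does the robber, to a twin that the cop does not occupy.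
    Otherwise the cop, still on the robber's side, can only have stayed put.\<close>
  have safe: "even (c i + r i) \<and> c i \<noteq> r i" if "i \<le> t" for i
    using that
  proof (induction i)
    case 0
    have "k 0 \<le> L" "even (k 0) \<longleftrightarrow> even (c 0)"
      using inv[of 0] by (simp_all add: start(2))
    thus ?case
      using avoid[of "k 0" "c 0"] by (auto simp: start(1))
  next
    case (Suc i)
    hence IH: "even (c i + r i)" "c i \<noteq> r i"
      by simp_all
    show ?case
    proof (cases "odd (c (Suc i) + r i)")
      case True
      with Suc.prems have "r (Suc i) = avoid (Suc (k i)) (c (Suc i))" "Suc (k i) \<le> L"
        using move[of i] k_less[of i] by simp_all
      thus ?thesis
        using avoid[of "Suc (k i)" "c (Suc i)"] True inv[of i] by auto
    next
      case False
      thus ?thesis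
        using stay[of i] IH cop_move[of i] by auto
    qed
  qed
  have "c (Suc i) \<noteq> r i" if "i < t" for i
    using safe[of i] cop_move[of i] that by auto
  with safe have "\<not> captured_within \<sigma> r t"
    by (simp add: captured_within_def cops_at) metis
  thus False
    using captured[OF play] by contradiction
qed

section \<open>Capture time quadratic in the number of vertices\<close>

theorem theorem5p2:
  shows "\<exists>c::real. c > 0 \<and>
    infinite {n::nat. n > 0 \<and>
      (\<exists>G :: nat pair_pre_digraph. pair_graph G \<and> card (pverts G) = n \<and>
         bb_cop_number G = 1 \<and> real (bb_capture_time G) \<ge> c * real n ^ 2)}"
    (is "\<exists>c. _ \<and> infinite (?S c)")
proof (intro exI conjI)
  \<comment> \<open>With \<open>m = 8 * h\<close> and twins there are \<open>16 * h\<close>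
    vertices, and the trail length \<open>4 * h\<^sup>2\<close> is
    \<open>(16 * h)\<^sup>2 / 64\<close>.\<close>
  have "16 * h \<in> ?S (1 / 64)" if h: "h > 0" for h
  proof (intro CollectI conjI exI)
    let ?G = "parity_graph (16 * h)"
    show "pair_graph ?G"
      by (rule pair_graph_parity_graph)
    show number: "bb_cop_number ?G = 1"
      using h by (simp add: bb_cop_number_parity_graph)
    \<comment> \<open>The cop's upper bound ensures that the \<open>LEAST\<close> in
      \<open>bb_capture_time\<close> is attained.\<close>
    have "cops_win_within ?G 1 (bb_capture_time ?G)"
      unfolding bb_capture_time_def number
      by (rule LeastI, rule cops_win_within_parity_graph) (use h in simp)
    hence "4 * h\<^sup>2 \<le> bb_capture_time ?G"
      using trail_length_le_capture_time[of "4 * h\<^sup>2" "8 * h" "trail h"]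
      by (simp add: h trail_less trail_edges_distinct)
    hence "real (4 * h\<^sup>2) \<le> real (bb_capture_time ?G)"
      by (simp only: of_nat_le_iff)
    thus "1 / 64 * real (16 * h) ^ 2 \<le> real (bb_capture_time ?G)"
      by (simp add: power_mult_distrib)
  qed (use h in simp_all)
  hence "(\<lambda>h. 16 * h) ` {0<..} \<subseteq> ?S (1 / 64)"
    by blast
  moreover have "infinite ((\<lambda>h. 16 * h) ` {0::nat<..})"
    by (subst finite_image_iff) (auto simp: inj_on_def infinite_Ioi)
  ultimately show "infinite (?S (1 / 64))"
    by (rule infinite_super)
qed simp

end
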